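(* Let $\Gamma=(X,\mathcal E)$ be the complete graph $K_4$ (the distance-regular graph with $4$ vertices and intersection array $\{3;1\}$); the spectrum of its adjacency matrix $A$ is $3^1(-1)^3$. Let $x\in X$, $T=T(x)$, and fix any ordering of the three vertices of $\Gamma_1(x)$. Then the standard module $V=\mathbb C^X$ is an orthogonal direct sum of irreducible $T$-modules $V=W_0\oplus W_{1,a}\oplus W_{1,b}$, where two summands are isomorphic if and only if they have the same type in the following list, and the data are as listed. Each listed basis is a pure basis of the module. For each summand other than $W_0$, the seed vector $\nu$ spans $E_r^*W$ (so $\dim E_r^*W=1$), where $r$ is the endpoint of the summand $W$, and is given by its essential part. Type I ($W_0$): endpoint 0, multiplicity 1, dimension 2, diameter 1, shape $(1,1)$; basis $e_0^*,e_1^*$; matrix representing $A$: $\begin{pmatrix}0&3\\1&2\end{pmatrix}$, with eigenvalues $3,-1$. Type II ($W_{1,a},W_{1,b}$): endpoint 1, multiplicity 2, dimension 1, diameter 0, shape $(1)$; basis $\nu$, where $\nu=[1,-1,0]$ for $W_{1,a}$ and $\nu=[1,1,-2]$ for $W_{1,b}$; matrix representing $A$: $\begin{pmatrix}-1\end{pmatrix}$, with eigenvalue $-1$. Moreover $\dim T=2^2+1^2=5$.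
   Context: Let $\Gamma=(X,\mathcal E)$ be a finite undirected connected graph without loops or multiple edges, with path-length distance $d$ and diameter $D\ge1$; put $\Gamma_i(x)=\{y\in X:d(x,y)=i\}$. $\Gamma$ is distance-regular if for all $0\le h,i,j\le D$ the number $p^h_{i,j}=|\Gamma_i(y)\cap\Gamma_j(z)|$ is the same for all $y,z\in X$ with $d(y,z)=h$. Its intersection array is $\{b_0,\dots,b_{D-1};c_1,\dots,c_D\}$ with $b_i=p^i_{1,i+1}$, $c_i=p^i_{1,i-1}$. $A\in\mathrm{Mat}_X(\mathbb C)$ is the adjacency matrix; in its spectrum, exponents denote multiplicities. The standard module $V=\mathbb C^X$ (column vectors) carries the Hermitian inner product $\langle u,v\rangle=u^t\bar v$. Fix a base vertex $x\in X$. For $0\le i\le D$, $E_i^*=E_i^*(x)$ is the diagonal matrix with $(y,y)$-entry $1$ if $d(x,y)=i$ and $0$ otherwise, and $e_i^*\in V$ is the vector with $y$-entry $1$ if $d(x,y)=i$ and $0$ otherwise. The Terwilliger algebra $T=T(x)$ is the subalgebra of $\mathrm{Mat}_X(\mathbb C)$ generated by $A$ and $E_0^*,\dots,E_D^*$. A $T$-module is a subspace $W\subseteq V$ with $BW\subseteq W$ for all $B\in T$; it is irreducible if $W\ne0$ and it properly contains no nonzero $T$-module. Isomorphisms of $T$-modules are vector space isomorphisms commuting with every $B\in T$. The endpoint of $W$ is $r=\min\{i:E_i^*W\ne0\}$; the diameter of an irreducible $W$ is $\delta=|\{i:E_i^*W\ne0\}|-1$, and its shape is $(\dim E_r^*W,\dots,\dim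 E_{r+\delta}^*W)$. The multiplicity of an irreducible module is the number of summands isomorphic to it in an orthogonal decomposition of $V$ into irreducible $T$-modules. A nonzero vector is pure with support $i$ if it lies in $E_i^*V$; its essential part is the row vector of its coordinates at the vertices of $\Gamma_i(x)$ (all its other coordinates are $0$). A pure basis of an irreducible $T$-module is an ordered basis of pure vectors with weakly increasing supports. The matrix $B$ representing $A$ with respect to a basis $v_1,\dots,v_\ell$ is given by $Av_j=\sum_iB_{ij}v_i$. *)

theory Defs
  imports "HOL-Analysis.Analysis" "Jordan_Normal_Form.Char_Poly"
begin

section \<open>Graphs\<close>

text \<open>A graph with vertex set \<open>X\<close> is given by its adjacency relation on a finite type \<open>'x\<close>
  (the type plays the role of \<open>X\<close>).\<close>

definition gdist :: "('x \<Rightarrow> 'x \<Rightarrow> bool) \<Rightarrow> 'x \<Rightarrow> 'x \<Rightarrow> nat" where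
  "gdist E y z = (LEAST n. (E ^^ n) y z)"

definition gdiam :: "('x::finite \<Rightarrow> 'x \<Rightarrow> bool) \<Rightarrow> nat" where
  "gdiam E = Max {gdist E y z | y z. True}"

definition gsphere :: "('x \<Rightarrow> 'x \<Rightarrow> bool) \<Rightarrow> nat \<Rightarrow> 'x \<Rightarrow> 'x set" where
  "gsphere E i y = {z. gdist E y z = i}"

definition connected_graph :: "('x::finite \<Rightarrow> 'x \<Rightarrow> bool) \<Rightarrow> bool" where
  "connected_graph E \<longleftrightarrow>
     symp E \<and> irreflp E \<and> (\<forall>y z. E\<^sup>*\<^sup>* y z) \<and> gdiam E \<ge> 1"

definition distance_regular :: "('x::finite \<Rightarrow> 'x \<Rightarrow> bool) \<Rightarrow> bool" where
  "distance_regular E \<longleftrightarrow> connected_graph E \<and>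
     (\<forall>h \<le> gdiam E. \<forall>i \<le> gdiam E. \<forall>j \<le> gdiam E. \<exists>p. \<forall>y z. gdist E y z = h \<longrightarrow>
        card (gsphere E i y \<inter> gsphere E j z) = p)"

text \<open>The value of \<open>p\<^sup>h\<^sub>i\<^sub>j\<close> is only meaningful for distance-regular graphs and \<open>h, i, j\<close> up to
  the diameter; then some pair of vertices is at distance \<open>h\<close>, so the value is unique.\<close>

definition intersection_number :: "('x::finite \<Rightarrow> 'x \<Rightarrow> bool) \<Rightarrow> nat \<Rightarrow> nat \<Rightarrow> nat \<Rightarrow> nat" where
  "intersection_number E h i j =
     (THE p. \<forall>y z. gdist E y z = h \<longrightarrow> card (gsphere E i y \<inter> gsphere E j z) = p)"

text \<open>The pair \<open>([b\<^sub>0, \<dots>, b\<^sub>D\<^sub>-\<^sub>1], [c\<^sub>1, \<dots>, c\<^sub>D])\<close>.\<close>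

definition intersection_array :: "('x::finite \<Rightarrow> 'x \<Rightarrow> bool) \<Rightarrow> nat list \<times> nat list" where
  "intersection_array E =
     (map (\<lambda>i. intersection_number E i 1 (i + 1)) [0..<gdiam E],
      map (\<lambda>i. intersection_number E i 1 (i - 1)) [1..<gdiam E + 1])"

definition complete_graph :: "('x \<Rightarrow> 'x \<Rightarrow> bool) \<Rightarrow> bool" where
  "complete_graph E \<longleftrightarrow> (\<forall>y z. E y z \<longleftrightarrow> y \<noteq> z)"

definition adjacency_matrix :: "('x::finite \<Rightarrow> 'x \<Rightarrow> bool) \<Rightarrow> complex^'x^'x" where
  "adjacency_matrix E = (\<chi> y z. if E y z then 1 else 0)"

text \<open>The spectrum is the multiset of roots of the characteristic polynomial \<open>det (t I - M)\<close>.\<close>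

definition spectrum_mset :: "complex^'x^'x \<Rightarrow> complex multiset" where
  "spectrum_mset M = proots (Determinants.det
     ((\<chi> y z. (if y = z then [:0, 1:] else 0) - [: M $ y $ z :]) :: complex poly^'x^'x))"


section \<open>The Terwilliger algebra and its modules\<close>

definition hermitian_inner :: "complex^'x \<Rightarrow> complex^'x \<Rightarrow> complex" where
  "hermitian_inner u v = (\<Sum>y\<in>UNIV. u $ y * cnj (v $ y))"

definition dual_idem :: "('x::finite \<Rightarrow> 'x \<Rightarrow> bool) \<Rightarrow> 'x \<Rightarrow> nat \<Rightarrow> complex^'x^'x" where
  "dual_idem E x i = (\<chi> y z. if y = z \<and> gdist E x y = i then 1 else 0)"

definition estar :: "('x::finite \<Rightarrow> 'x \<Rightarrow> bool) \<Rightarrow> 'x \<Rightarrow> nat \<Rightarrow> complex^'x" where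
  "estar E x i = (\<chi> y. if gdist E x y = i then 1 else 0)"

text \<open>Complex scalar multiplication on matrices; the library only provides it for vectors
  (and real scalars).\<close>

definition smult_matrix :: "complex \<Rightarrow> complex^'x^'x \<Rightarrow> complex^'x^'x" where
  "smult_matrix c M = (\<chi> y z. c * M $ y $ z)"

global_interpretation matrix_vs: vector_space "smult_matrix :: complex \<Rightarrow> complex^'x^'x \<Rightarrow> complex^'x^'x"
  by unfold_locales (simp_all add: smult_matrix_def Finite_Cartesian_Product.vec_eq_iff algebra_simps)

inductive_set generated_subalgebra :: "(complex^'x^'x) set \<Rightarrow> (complex^'x^'x) set"
  for S :: "(complex^'x^'x) set" where
  gen: "M \<in> S \<Longrightarrow> M \<in> generated_subalgebra S"
| one: "Finite_Cartesian_Product.mat 1 \<in> generated_subalgebra S"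
| add: "M \<in> generated_subalgebra S \<Longrightarrow> N \<in> generated_subalgebra S \<Longrightarrow>
          M + N \<in> generated_subalgebra S"
| scale: "M \<in> generated_subalgebra S \<Longrightarrow> smult_matrix c M \<in> generated_subalgebra S"
| mult: "M \<in> generated_subalgebra S \<Longrightarrow> N \<in> generated_subalgebra S \<Longrightarrow>
          M ** N \<in> generated_subalgebra S"

definition terwilliger_algebra :: "('x::finite \<Rightarrow> 'x \<Rightarrow> bool) \<Rightarrow> 'x \<Rightarrow> (complex^'x^'x) set" where
  "terwilliger_algebra E x =
     generated_subalgebra (insert (adjacency_matrix E) (dual_idem E x ` {0..gdiam E}))"

definition T_module :: "(complex^'x^'x) set \<Rightarrow> (complex^'x) set \<Rightarrow> bool" where
  "T_module T W \<longleftrightarrow> vec.subspace W \<and> (\<forall>B\<in>T. \<forall>w\<in>W. B *v w \<in> W)"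

definition irreducible_T_module :: "(complex^'x^'x) set \<Rightarrow> (complex^'x) set \<Rightarrow> bool" where
  "irreducible_T_module T W \<longleftrightarrow> T_module T W \<and> W \<noteq> {0} \<and>
     \<not> (\<exists>U. T_module T U \<and> U \<noteq> {0} \<and> U \<subset> W)"

definition T_isomorphic ::
  "(complex^'x^'x) set \<Rightarrow> (complex^'x) set \<Rightarrow> (complex^'x) set \<Rightarrow> bool" where
  "T_isomorphic T W W' \<longleftrightarrow> (\<exists>f. bij_betw f W W' \<and>
     (\<forall>u\<in>W. \<forall>v\<in>W. f (u + v) = f u + f v) \<and>
     (\<forall>c. \<forall>u\<in>W. f (c *s u) = c *s f u) \<and>
     (\<forall>B\<in>T. \<forall>u\<in>W. f (B *v u) = B *v f u))"

definition orthogonal_decomposition :: "(complex^'x^'x) set \<Rightarrow> (complex^'x) set list \<Rightarrow> bool" where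
  "orthogonal_decomposition T Ws \<longleftrightarrow>
     (\<forall>W\<in>set Ws. irreducible_T_module T W) \<and>
     (\<forall>i<length Ws. \<forall>j<length Ws. i \<noteq> j \<longrightarrow>
        (\<forall>u\<in>Ws ! i. \<forall>v\<in>Ws ! j. hermitian_inner u v = 0)) \<and>
     vec.span (\<Union> (set Ws)) = UNIV"

text \<open>The multiplicity does not depend on the decomposition, which makes the description unique.\<close>

definition T_multiplicity :: "(complex^'x^'x) set \<Rightarrow> (complex^'x) set \<Rightarrow> nat" where
  "T_multiplicity T W = (THE m. \<exists>Ws. orthogonal_decomposition T Ws \<and>
     m = length (filter (T_isomorphic T W) Ws))"

text \<open>The subspace \<open>E\<^sub>i\<^sup>* W\<close>.\<close>

definition component ::
  "('x::finite \<Rightarrow> 'x \<Rightarrow> bool) \<Rightarrow> 'x \<Rightarrow> nat \<Rightarrow> (complex^'x) set \<Rightarrow> (complex^'x) set" where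
  "component E x i W = (\<lambda>w. dual_idem E x i *v w) ` W"

definition module_support :: "('x::finite \<Rightarrow> 'x \<Rightarrow> bool) \<Rightarrow> 'x \<Rightarrow> (complex^'x) set \<Rightarrow> nat set" where
  "module_support E x W = {i. i \<le> gdiam E \<and> component E x i W \<noteq> {0}}"

definition module_endpoint :: "('x::finite \<Rightarrow> 'x \<Rightarrow> bool) \<Rightarrow> 'x \<Rightarrow> (complex^'x) set \<Rightarrow> nat" where
  "module_endpoint E x W = Min (module_support E x W)"

definition module_diameter :: "('x::finite \<Rightarrow> 'x \<Rightarrow> bool) \<Rightarrow> 'x \<Rightarrow> (complex^'x) set \<Rightarrow> nat" where
  "module_diameter E x W = card (module_support E x W) - 1"

definition module_shape :: "('x::finite \<Rightarrow> 'x \<Rightarrow> bool) \<Rightarrow> 'x \<Rightarrow> (complex^'x) set \<Rightarrow> nat list" where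
  "module_shape E x W = map (\<lambda>i. vec.dim (component E x i W))
     [module_endpoint E x W ..< module_endpoint E x W + module_diameter E x W + 1]"


section \<open>Pure bases and matrix representations\<close>

definition pure_vector :: "('x::finite \<Rightarrow> 'x \<Rightarrow> bool) \<Rightarrow> 'x \<Rightarrow> nat \<Rightarrow> complex^'x \<Rightarrow> bool" where
  "pure_vector E x i v \<longleftrightarrow> v \<noteq> 0 \<and> v \<in> component E x i UNIV"

definition ordered_basis :: "(complex^'x) set \<Rightarrow> (complex^'x) list \<Rightarrow> bool" where
  "ordered_basis W vs \<longleftrightarrow> distinct vs \<and> vec.independent (set vs) \<and> vec.span (set vs) = W"

definition pure_basis ::
  "('x::finite \<Rightarrow> 'x \<Rightarrow> bool) \<Rightarrow> 'x \<Rightarrow> (complex^'x) set \<Rightarrow> (complex^'x) list \<Rightarrow> bool" where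
  "pure_basis E x W vs \<longleftrightarrow> ordered_basis W vs \<and>
     (\<exists>is. sorted is \<and> list_all2 (pure_vector E x) is vs)"

text \<open>\<open>ys\<close> is an ordering of the vertices in the sphere that supports the pure vector \<open>v\<close>.\<close>

definition essential_part :: "'x list \<Rightarrow> complex^'x \<Rightarrow> complex list" where
  "essential_part ys v = map (vec_nth v) ys"

definition represents_wrt ::
  "complex Matrix.mat \<Rightarrow> complex^'x^'x \<Rightarrow> (complex^'x) list \<Rightarrow> bool" where
  "represents_wrt B M vs \<longleftrightarrow> B \<in> carrier_mat (length vs) (length vs) \<and>
     (\<forall>j<length vs. M *v (vs ! j) = (\<Sum>i<length vs. B $$ (i, j) *s vs ! i))"

end

(* The stabiliser of x in Sym(X) acts on the pairs of vertices with orbits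
   {(x,x)}, {x} x Y, Y x {x}, the diagonal of Y x Y and its complement, where Y = X - {x}.
   All generators of T are constant on these orbits, and matrices with this property are
   closed under multiplication, so T is contained in their span; conversely each orbit
   indicator is a word in A, E*_0, E*_1. This gives dim T = 5.

   If a T-module W contains a vector w with w_x nonzero, then E*_0 w and A E*_0 w show that
   W contains the span W_0 of e*_0 and e*_1. Otherwise every w in W satisfies w_x = 0 and
   (A w)_x = 0, so its coordinates sum to 0, and on such vectors T acts by scalars. Hence the
   irreducible modules are W_0 and the lines of zero-sum vectors vanishing at x, and comparing
   dimensions in an orthogonal decomposition yields the multiplicities 1 and |X| - 2. *)

theory Submission
  imports Defs
begin

no_notation Matrix.vec_index (infixl "$" 100)

section \<open>Modules of the Terwilliger algebra\<close>

text \<open>The matrices that preserve a given subspace form a unital algebra, so invariance under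
  the generators spreads to all of T. Every later check of a module reduces to \<open>A\<close> and
  the dual idempotents.\<close>

lemma terwilliger_module_iff_generators:
  "T_module (terwilliger_algebra E x) W \<longleftrightarrow> vec.subspace W \<and>
     (\<forall>w\<in>W. adjacency_matrix E *v w \<in> W) \<and>
     (\<forall>i\<le>gdiam E. \<forall>w\<in>W. dual_idem E x i *v w \<in> W)" (is "?L \<longleftrightarrow> ?R")
proof
  assume ?L
  then show ?R
    unfolding T_module_def terwilliger_algebra_def
    by (auto 0 4 intro: generated_subalgebra.gen)
next
  assume R: ?R
  have scale: "smult_matrix c M *v w = c *s (M *v w)" for c M and w :: "complex^'a"
    by (simp add: smult_matrix_def matrix_vector_mult_def Finite_Cartesian_Product.vec_eq_iff
        sum_distrib_left mult_ac)
  have "\<forall>w\<in>W. B *v w \<in> W" if "B \<in> terwilliger_algebra E x" for B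
    using that unfolding terwilliger_algebra_def
  proof (induction B rule: generated_subalgebra.induct)
    case (mult M N)
    then show ?case
      by (metis matrix_vector_mul_assoc)
  qed (use R in \<open>auto simp: matrix_vector_mult_add_rdistrib scale vec.subspace_add vec.subspace_scale\<close>)
  then show ?L
    using R by (auto simp: T_module_def)
qed

section \<open>Orthogonality and dimensions of orthogonal sums\<close>

lemma hermitian_inner_self_eq_0_iff: "hermitian_inner u u = 0 \<longleftrightarrow> u = 0"
proof -
  have "hermitian_inner u u = of_real (\<Sum>y\<in>UNIV. (cmod (u $ y))\<^sup>2)"
    by (simp add: hermitian_inner_def complex_norm_square del: of_real_power)
  then have "hermitian_inner u u = 0 \<longleftrightarrow> (\<Sum>y\<in>UNIV. (cmod (u $ y))\<^sup>2) = 0"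
    by (simp only: of_real_eq_0_iff)
  then show ?thesis
    by (auto simp: sum_nonneg_eq_0_iff Finite_Cartesian_Product.vec_eq_iff)
qed

lemma hermitian_inner_span_left:
  assumes "\<forall>w\<in>S. hermitian_inner w u = 0" "v \<in> vec.span S"
  shows "hermitian_inner v u = 0"
  using assms(2)
proof (induction rule: vec.span_induct_alt)
  case base
  then show ?case by (simp add: hermitian_inner_def)
next
  case (step c w v)
  have "hermitian_inner (c *s w + v) u = c * hermitian_inner w u + hermitian_inner v u"
    by (simp add: hermitian_inner_def sum.distrib sum_distrib_left algebra_simps)
  with step assms(1) show ?case by simp
qed

lemma hermitian_inner_span_right:
  assumes "\<forall>w\<in>S. hermitian_inner u w = 0" "v \<in> vec.span S"
  shows "hermitian_inner u v = 0"
proof -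
  have comm: "hermitian_inner a b = cnj (hermitian_inner b a)" for a b :: "complex^'a"
    by (simp add: hermitian_inner_def mult.commute)
  then have "\<forall>w\<in>S. hermitian_inner w u = 0" using assms(1) by (metis complex_cnj_zero)
  then show ?thesis using hermitian_inner_span_left[OF _ assms(2)] comm by (metis complex_cnj_zero)
qed

text \<open>Induction on the list. The head is orthogonal to the span of the tail, so by positive
  definiteness the two meet only in 0, and the dimension formula for a sum of two subspaces has no
  correction term.\<close>

lemma dim_span_orthogonal_subspaces:
  fixes Ws :: "(complex^'x::finite) set list"
  assumes "\<forall>W\<in>set Ws. vec.subspace W"
    and "\<forall>i<length Ws. \<forall>j<length Ws. i \<noteq> j \<longrightarrow>
           (\<forall>u\<in>Ws ! i. \<forall>v\<in>Ws ! j. hermitian_inner u v = 0)"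
  shows "vec.dim (vec.span (\<Union> (set Ws))) = sum_list (map vec.dim Ws)"
  using assms
proof (induction Ws)
  case (Cons W Ws)
  let ?S = "vec.span (\<Union> (set Ws))"
  have IH: "vec.dim ?S = sum_list (map vec.dim Ws)"
  proof (rule Cons.IH)
    show "\<forall>i<length Ws. \<forall>j<length Ws. i \<noteq> j \<longrightarrow>
           (\<forall>u\<in>Ws ! i. \<forall>v\<in>Ws ! j. hermitian_inner u v = 0)"
    proof (intro allI impI)
      fix i j assume "i < length Ws" "j < length Ws" "i \<noteq> j"
      then show "\<forall>u\<in>Ws ! i. \<forall>v\<in>Ws ! j. hermitian_inner u v = 0"
        using Cons.prems(2)[rule_format, of "Suc i" "Suc j"] by simp
    qed
  qed (use Cons.prems in auto)
  have W: "vec.subspace W" using Cons.prems by simp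
  have "hermitian_inner v u = 0" if "u \<in> W" "v \<in> ?S" for u v
  proof (rule hermitian_inner_span_left[OF _ that(2)], safe)
    fix w V assume "w \<in> V" "V \<in> set Ws"
    then obtain j where "j < length Ws" "w \<in> Ws ! j" by (metis in_set_conv_nth)
    then show "hermitian_inner w u = 0"
      using Cons.prems(2)[rule_format, of "Suc j" 0] that by auto
  qed
  then have "w = 0" if "w \<in> W" "w \<in> ?S" for w
    using that by (simp flip: hermitian_inner_self_eq_0_iff)
  then have "W \<inter> ?S = {0}"
    using W by (auto simp: vec.subspace_0 vec.span_zero)
  moreover have "vec.span (\<Union> (set (W # Ws))) = {a + b |a b. a \<in> W \<and> b \<in> ?S}"
    by (simp add: vec.span_Un vec.span_eq_iff[THEN iffD2, OF W])
  ultimately show ?case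
    using vec.dim_sums_Int[OF W vec.subspace_span, of "\<Union> (set Ws)"] IH by simp
qed simp

section \<open>Dual idempotents, pure vectors and module isomorphisms\<close>

lemma dual_idem_mult_nth: "(dual_idem E x i *v w) $ y = (if gdist E x y = i then w $ y else 0)"
  by (simp add: dual_idem_def matrix_vector_mult_def if_distrib [of "\<lambda>t. t * _"]
      flip: if_if_eq_conj cong: if_cong)

lemma dual_idem_mult_estar: "dual_idem E x i *v estar E x j = (if i = j then estar E x j else 0)"
  by (simp add: Finite_Cartesian_Product.vec_eq_iff dual_idem_mult_nth estar_def)

lemma component_span: "component E x i (vec.span S) = vec.span ((*v) (dual_idem E x i) ` S)"
  unfolding component_def
  by (rule module_hom.span_image[OF Vector_Spaces.linear.axioms(3)[OF matrix_vector_mul_linear_gen], symmetric])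

lemma pure_vector_iff: "pure_vector E x i v \<longleftrightarrow> v \<noteq> 0 \<and> dual_idem E x i *v v = v"
  unfolding pure_vector_def component_def
  by (auto simp: Finite_Cartesian_Product.vec_eq_iff dual_idem_mult_nth image_iff)

text \<open>An isomorphism is injective, sends 0 to 0 and commutes with \<open>B\<close>, so
  \<open>B\<close> kills a vector exactly when it kills its image. Annihilation by an element of T
  is thus an invariant that can tell modules apart.\<close>

lemma T_isomorphic_kernel_iff:
  assumes iso: "T_isomorphic T W W'" and W: "T_module T W" and B: "B \<in> T"
  shows "(\<forall>w\<in>W. B *v w = 0) \<longleftrightarrow> (\<forall>w\<in>W'. B *v w = 0)"
proof -
  obtain f where f: "bij_betw f W W'" "\<forall>c. \<forall>u\<in>W. f (c *s u) = c *s f u"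
    "\<forall>B\<in>T. \<forall>u\<in>W. f (B *v u) = B *v f u"
    using iso unfolding T_isomorphic_def by blast
  have W0: "0 \<in> W" and WB: "\<And>w. w \<in> W \<Longrightarrow> B *v w \<in> W"
    using W B by (auto simp: T_module_def vec.subspace_0)
  have f0: "f 0 = 0" using f(2)[rule_format, OF W0, of 0] by simp
  have "B *v w = 0 \<longleftrightarrow> B *v f w = 0" if "w \<in> W" for w
  proof -
    have "B *v w = 0 \<longleftrightarrow> f (B *v w) = f 0"
      using f(1) W0 WB[OF that] by (auto simp: bij_betw_def inj_on_eq_iff)
    then show ?thesis using f(3) B that f0 by simp
  qed
  moreover have "W' = f ` W" using f(1) by (simp add: bij_betw_def)
  ultimately show ?thesis by auto
qed

lemma T_isomorphic_refl: "T_isomorphic T W W"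
  unfolding T_isomorphic_def by (rule exI[of _ id]) auto

text \<open>If every \<open>B\<close> acts on both lines by the same scalar, any linear bijection
  between the lines commutes with the action.\<close>

lemma T_isomorphic_lines:
  assumes "u \<noteq> 0" "v \<noteq> 0" and scalar: "\<forall>B\<in>T. \<exists>c. B *v u = c *s u \<and> B *v v = c *s v"
  shows "T_isomorphic T (vec.span {u}) (vec.span {v})"
proof -
  obtain y where y: "u $ y \<noteq> 0"
    using assms(1) by (auto simp: Finite_Cartesian_Product.vec_eq_iff)
  \<comment> \<open>The coefficient of a multiple of \<open>u\<close> is read off at a coordinate
    where \<open>u\<close> does not vanish; this formula is visibly linear in
    \<open>w\<close>.\<close>
  define f where "f w = (w $ y / u $ y) *s v" for w
  have fu: "f (k *s u) = k *s v" for k using y by (simp add: f_def)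
  have "bij_betw f (vec.span {u}) (vec.span {v})"
    unfolding bij_betw_def inj_on_def vec.span_singleton
    using assms(2) by (auto simp: fu image_image)
  moreover have "f (B *v w) = B *v f w" if B: "B \<in> T" and w: "w \<in> vec.span {u}" for B w
  proof -
    obtain k where k: "w = k *s u" using w by (auto simp: vec.span_singleton)
    obtain c where c: "B *v u = c *s u" "B *v v = c *s v" using scalar B by blast
    show ?thesis
      by (simp only: k fu vec.scale vector_scalar_commute c vector_smult_assoc)
  qed
  ultimately show ?thesis
    unfolding T_isomorphic_def
    by (intro exI[of _ f]) (auto simp: f_def add_divide_distrib vector_sadd_rdistrib vector_smult_assoc)
qed

section \<open>Complete graphs\<close>

lemma gdist_self [simp]: "gdist E y y = 0"
  unfolding gdist_def by (rule Least_eq_0) simp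

text \<open>The assumed walk ensures that the \<open>LEAST\<close> in \<open>gdist\<close> is
  attained; without any walk the distance is an unspecified number.\<close>

lemma gdist_eq_0_imp_eq:
  assumes "(E ^^ n) y z" "gdist E y z = 0"
  shows "y = z"
  using LeastI[of "\<lambda>n. (E ^^ n) y z", OF assms(1)] assms(2) by (simp add: gdist_def)

lemma gdist_le_gdiam: "gdist E y z \<le> gdiam E"
proof -
  have "{gdist E y z |y z. True} = (\<lambda>(y, z). gdist E y z) ` UNIV" by auto
  then have "finite {gdist E y z |y z. True}" by simp
  then show ?thesis unfolding gdiam_def by (intro Max_ge) auto
qed

lemma complete_graph_gdist:
  assumes "complete_graph E"
  shows "gdist E y z = (if y = z then 0 else 1)"
proof (cases "y = z")
  case False
  then have "E y z" using assms by (simp add: complete_graph_def)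
  then have "(E ^^ 1) y z" by (simp add: eq_OO)
  moreover have "(E ^^ n) y z \<Longrightarrow> 1 \<le> n" for n
    using False by (cases n) auto
  ultimately have "gdist E y z = 1"
    unfolding gdist_def by (rule Least_equality)
  with False show ?thesis by simp
qed simp

text \<open>Distinct vertices have positive distance, the diameter bounds it by 1, and a walk of
  length 1 is an edge.\<close>

lemma connected_graph_gdiam_1_imp_complete:
  assumes "connected_graph E" "gdiam E = 1"
  shows "complete_graph E"
  unfolding complete_graph_def
proof (intro allI iffI)
  fix y z
  show "y \<noteq> z" if "E y z"
    using assms(1) that by (auto simp: connected_graph_def irreflp_def)
  show "E y z" if "y \<noteq> z"
  proof -
    obtain n where n: "(E ^^ n) y z"
      using assms(1) by (auto simp: connected_graph_def rtranclp_power)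
    have "(E ^^ gdist E y z) y z"
      unfolding gdist_def using n by (rule LeastI)
    moreover have "gdist E y z = 1"
      using gdist_eq_0_imp_eq[OF n] that gdist_le_gdiam[of E y z] assms(2) by linarith
    ultimately show ?thesis by (simp add: eq_OO)
  qed
qed

text \<open>The matrix is \<alpha> - \<beta> times the identity plus \<beta> times the all-ones
  matrix. A general commutative ring is allowed so that polynomial entries, as in a characteristic
  matrix, are covered.\<close>

lemma det_constant_off_diagonal_4:
  fixes \<alpha> \<beta> :: "'a::comm_ring_1"
  assumes "CARD('x::finite) = 4"
  shows "Determinants.det (\<chi> (y::'x) (z::'x). if y = z then \<alpha> else \<beta>) = (\<alpha> - \<beta>) ^ 3 * (\<alpha> + 3 * \<beta>)"
proof -
  obtain S where "distinct S" "set S = (UNIV :: 'x set)" "length S = 4"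
    using assms finite_distinct_list[of "UNIV :: 'x set"] by (metis distinct_card finite)
  then obtain a b c d where dist: "distinct [a, b, c, d]" and UNIV: "(UNIV :: 'x set) = {a, b, c, d}"
    by (auto simp: numeral_eq_Suc length_Suc_conv)
  have f: "finite {b, c, d}" "a \<notin> {b, c, d}" "finite {c, d}" "b \<notin> {c, d}" "finite {d}" "c \<notin> {d}"
    using dist by auto
  have neq: "a \<noteq> b" "b \<noteq> a" "a \<noteq> c" "c \<noteq> a" "a \<noteq> d" "d \<noteq> a"
    "b \<noteq> c" "c \<noteq> b" "b \<noteq> d" "d \<noteq> b" "c \<noteq> d" "d \<noteq> c"
    using dist by auto
  show ?thesis
    unfolding Determinants.det_def UNIV
    \<comment> \<open>The Leibniz sum is expanded into its 24 terms: each permutation of a set with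
      one point added is a transposition composed with a permutation of the remaining
      points.\<close>
    unfolding sum_over_permutations_insert[OF f(1,2)] sum_over_permutations_insert[OF f(3,4)]
      sum_over_permutations_insert[OF f(5,6)] permutes_sing
    apply (simp add: neq f sign_swap_id permutation_swap_id sign_compose permutation_compose)
    apply (simp add: power3_eq_cube algebra_simps)
    done
qed

lemma det_2x2_expansion:
  assumes "A \<in> carrier_mat 2 2"
  shows "Determinant.det A = A $$ (0,0) * A $$ (1,1) - A $$ (0,1) * A $$ (1,0)"
  using assms laplace_expansion_row[OF assms, of 0]
  by (simp add: numeral_2_eq_2 cofactor_def Determinant.det_single mat_delete_def)

text \<open>The number of vertices stays general, with two as the bound that gives diameter 1. The
  value 4 enters only with the numerical data.\<close>

locale complete_graph_vertex =
  fixes E :: "'x::finite \<Rightarrow> 'x \<Rightarrow> bool" and x :: 'x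
  assumes complete: "complete_graph E"
    and nontrivial: "2 \<le> CARD('x)"
begin

lemma adj_iff: "E y z \<longleftrightarrow> y \<noteq> z"
  using complete by (simp add: complete_graph_def)

lemmas gdist = complete_graph_gdist[OF complete]

lemma exists_other: "\<exists>z. z \<noteq> (y::'x)"
proof (rule ccontr)
  assume "\<nexists>z. z \<noteq> y"
  then have "UNIV = {y}" by auto
  then have "CARD('x) = 1" by (metis card.empty card.insert finite.emptyI empty_iff One_nat_def)
  with nontrivial show False by simp
qed

lemma gdiam: "gdiam E = 1"
proof -
  have "{gdist E y z |y z. True} = {0, 1}"
    using exists_other by (auto simp: gdist) metis+
  then show ?thesis by (simp add: gdiam_def)
qed

lemma gsphere_1: "gsphere E 1 y = - {y}"
  by (auto simp: gsphere_def gdist)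

text \<open>All intersection numbers at once. A sphere of radius 0 is a single vertex, and two
  spheres of radius 1 meet in the complement of \<open>{y, z}\<close>, a set with
  \<open>Suc h\<close> elements.\<close>

lemma card_gsphere_inter:
  assumes "h \<le> 1" "i \<le> 1" "j \<le> 1" "gdist E y z = h"
  shows "card (gsphere E i y \<inter> gsphere E j z) =
     (if i = 0 then (if j = h then 1 else 0)
      else if j = 0 then h
      else CARD('x) - Suc h)"
proof -
  have h: "h = (if y = z then 0 else 1)" using assms(4) by (simp add: gdist)
  consider "i = 0" | "i = 1" "j = 0" | "i = 1" "j = 1" using assms by linarith
  then show ?thesis
  proof cases
    case 1
    then have "gsphere E i y \<inter> gsphere E j z = (if j = h then {y} else {})"
      using h by (auto simp: gsphere_def gdist)
    with 1 show ?thesis by simp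
  next
    case 2
    then have "gsphere E i y \<inter> gsphere E j z = (if h = 1 then {z} else {})"
      using h by (auto simp: gsphere_def gdist)
    with 2 h show ?thesis by simp
  next
    case 3
    then have "gsphere E i y \<inter> gsphere E j z = UNIV - {y, z}"
      by (auto simp: gsphere_def gdist)
    moreover have "card {y, z} = Suc h" using h by simp
    ultimately show ?thesis using 3 by (simp add: card_Diff_subset)
  qed
qed

text \<open>The one pair at distance \<open>h\<close> in the first premise makes the number
  described by \<open>THE\<close> unique.\<close>

lemma intersection_number_eqI:
  assumes "gdist E y z = h" "\<And>y z. gdist E y z = h \<Longrightarrow> card (gsphere E i y \<inter> gsphere E j z) = p"
  shows "intersection_number E h i j = p"
  unfolding intersection_number_def using assms by (intro the_equality) blast+

lemma intersection_array: "intersection_array E = ([CARD('x) - 1], [1])"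
proof -
  \<comment> \<open>This number is \<open>b_0\<close>; the one computed next is
    \<open>c_1\<close>.\<close>
  have "intersection_number E 0 1 1 = CARD('x) - 1"
    by (rule intersection_number_eqI[of x x]) (simp, subst card_gsphere_inter, auto)
  moreover obtain z where z: "z \<noteq> x" using exists_other by blast
  have "intersection_number E 1 1 0 = 1"
    by (rule intersection_number_eqI[of x z]) (use z in \<open>simp add: gdist\<close>, subst card_gsphere_inter, auto)
  ultimately show ?thesis by (simp add: intersection_array_def gdiam)
qed

lemma distance_regular: "distance_regular E"
proof -
  have "E\<^sup>*\<^sup>* y z" for y z by (cases "y = z") (auto simp: adj_iff)
  then have "connected_graph E"
    by (auto simp: connected_graph_def gdiam adj_iff symp_def irreflp_def)
  moreover have "\<exists>p. \<forall>y z. gdist E y z = h \<longrightarrow> card (gsphere E i y \<inter> gsphere E j z) = p"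
    if "h \<le> 1" "i \<le> 1" "j \<le> 1" for h i j
    using card_gsphere_inter[OF that] by blast
  ultimately show ?thesis by (simp add: distance_regular_def gdiam)
qed

text \<open>The length of the first list of the array is the diameter, so the array forces diameter
  1 and hence completeness. A vertex set carries only one complete graph, which gives equality and
  not merely isomorphism.\<close>

lemma distance_regular_array_iff:
  "distance_regular F \<and> intersection_array F = ([CARD('x) - 1], [1]) \<longleftrightarrow> F = E"
proof
  assume F: "distance_regular F \<and> intersection_array F = ([CARD('x) - 1], [1])"
  then have "length (fst (intersection_array F)) = 1" by simp
  then have "gdiam F = 1" by (simp add: intersection_array_def)
  then have "complete_graph F"
    using F connected_graph_gdiam_1_imp_complete by (auto simp: distance_regular_def)
  then show "F = E" by (intro ext) (simp add: complete_graph_def adj_iff)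
qed (simp add: distance_regular intersection_array)

end

section \<open>Spectra of \<open>A\<close> and of its representing matrices\<close>

lemma spectrum_complete_graph_4:
  assumes "CARD('x::finite) = 4" and "complete_graph (E :: 'x \<Rightarrow> 'x \<Rightarrow> bool)"
  shows "spectrum_mset (adjacency_matrix E) = {#3#} + replicate_mset 3 (-1)"
proof -
  have "(\<chi> y z. (if y = z then [:0, 1:] else 0) - [: adjacency_matrix E $ y $ z :])
      = ((\<chi> y z. if y = z then [:0, 1:] else - 1) :: complex poly^'x^'x)"
    using assms(2)
    by (simp add: Finite_Cartesian_Product.vec_eq_iff adjacency_matrix_def complete_graph_def one_pCons)
  \<comment> \<open>With t on the diagonal and -1 elsewhere, the determinant formula gives (t + 1)^3
    (t - 3).\<close>
  then have "spectrum_mset (adjacency_matrix E) = proots ([:1, 1:] ^ 3 * [:-3, 1 :: complex:])"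
    using det_constant_off_diagonal_4[OF assms(1), of "[:0, 1:]" "- 1 :: complex poly"]
    by (simp add: spectrum_mset_def one_pCons numeral_poly)
  also have "\<dots> = {#3#} + replicate_mset 3 (-1)"
    by (subst proots_mult) (simp_all only: proots_power proots_linear_factor, simp_all add: numeral_3_eq_3)
  finally show ?thesis .
qed

text \<open>This is the quotient matrix of \<open>K_4\<close> for the partition into a vertex and
  its three neighbours; its characteristic polynomial t(t - 2) - 3 factors as (t - 3)(t +
  1).\<close>

lemma proots_char_poly_quotient:
  "proots (char_poly (mat_of_rows_list 2 [[0, 3], [1, 2 :: complex]])) = {#3, -1#}"
proof -
  let ?M = "mat_of_rows_list 2 [[0, 3], [1, 2 :: complex]]"
  have M: "?M \<in> carrier_mat 2 2"
    by (auto simp: mat_of_rows_list_def)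
  have entries: "char_poly_matrix ?M $$ (0,0) = [:0, 1:]" "char_poly_matrix ?M $$ (0,1) = [:-3:]"
    "char_poly_matrix ?M $$ (1,0) = [:-1:]" "char_poly_matrix ?M $$ (1,1) = [:-2, 1:]"
    by (simp_all add: char_poly_matrix_def mat_of_rows_list_def)
  have "char_poly ?M = [:-3, 1:] * [:1, 1:]"
    unfolding char_poly_def det_2x2_expansion[OF char_poly_matrix_closed[OF M]] entries
    by simp
  moreover have "proots ([:-3, 1:] * [:1, 1:] :: complex poly) = proots [:-3, 1:] + proots [:1, 1:]"
    by (rule proots_mult) simp_all
  ultimately show ?thesis by (simp only: proots_linear_factor) simp
qed

lemma proots_char_poly_line: "proots (char_poly (mat_of_rows_list 1 [[-1 :: complex]])) = {#-1#}"
proof -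
  have "char_poly (mat_of_rows_list 1 [[-1 :: complex]]) = [:1, 1:]"
    unfolding char_poly_def
    by (subst Determinant.det_single) (simp_all add: char_poly_matrix_def mat_of_rows_list_def one_pCons)
  then show ?thesis by simp
qed

lemma mult_span_subset:
  assumes "\<And>s. s \<in> S \<Longrightarrow> M *v s \<in> vec.span S" and "w \<in> vec.span S"
  shows "M *v w \<in> vec.span S"
  using assms(2)
proof (induction rule: vec.span_induct_alt)
  case (step c s w)
  then show ?case
    by (simp add: vec.add vec.scale vec.span_add vec.span_scale assms(1))
qed (simp add: vec.span_zero)

lemma span_singleton_nonzero: "u \<noteq> 0 \<Longrightarrow> vec.span {u} \<noteq> {0}"
  by (metis singletonD singletonI vec.span_base)

text \<open>\<open>\<kappa>\<close> colours the pairs of vertices. The indicator matrices of the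
  colours form a basis: each entry of a linear combination of them is a single coefficient, which
  yields both spanning and independence.\<close>

lemma dim_class_function_matrices:
  fixes \<kappa> :: "'x::finite \<Rightarrow> 'x \<Rightarrow> 'k"
  shows "matrix_vs.dim {M. \<exists>f. \<forall>y z. M $ y $ z = f (\<kappa> y z)} = card (range (case_prod \<kappa>))"
proof -
  define ind :: "'k \<Rightarrow> complex^'x^'x" where "ind k = (\<chi> y z. if \<kappa> y z = k then 1 else 0)" for k
  let ?V = "{M. \<exists>f. \<forall>y z. M $ y $ z = f (\<kappa> y z)} :: (complex^'x^'x) set"
  let ?K = "range (case_prod \<kappa>)"
  have fin: "finite ?K" by simp
  have \<kappa>K: "\<kappa> y z \<in> ?K" for y z by (metis case_prod_conv rangeI)
  have entry: "(\<Sum>k\<in>?K. smult_matrix (f k) (ind k)) $ y $ z = f (\<kappa> y z)" for f y z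
    using \<kappa>K[of y z] by (simp add: smult_matrix_def ind_def if_distrib[of "\<lambda>t. _ * t"] sum.delta[OF fin] cong: if_cong)
  have inj: "inj_on ind ?K"
  proof (rule inj_onI)
    fix k l assume "k \<in> ?K" "ind k = ind l"
    then obtain y z where "k = \<kappa> y z" "ind k $ y $ z = ind l $ y $ z" by auto
    then show "k = l" by (simp add: ind_def split: if_splits)
  qed
  show ?thesis
  proof (rule matrix_vs.dim_unique)
    show "ind ` ?K \<subseteq> ?V" by (auto simp: ind_def)
    show "?V \<subseteq> matrix_vs.span (ind ` ?K)"
    proof clarify
      fix M :: "complex^'x^'x" and f assume "\<forall>y z. M $ y $ z = f (\<kappa> y z)"
      then have "M = (\<Sum>k\<in>?K. smult_matrix (f k) (ind k))"
        by (simp add: Finite_Cartesian_Product.vec_eq_iff entry del: sum_component)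
      then show "M \<in> matrix_vs.span (ind ` ?K)"
        by (simp only:) (intro matrix_vs.span_sum matrix_vs.span_scale matrix_vs.span_base imageI)
    qed
    show "matrix_vs.independent (ind ` ?K)"
    proof (rule matrix_vs.independent_if_scalars_zero)
      fix f N assume 0: "(\<Sum>N\<in>ind ` ?K. smult_matrix (f N) N) = 0" and "N \<in> ind ` ?K"
      then obtain y z where N: "N = ind (\<kappa> y z)" by auto
      have "(\<Sum>k\<in>?K. smult_matrix (f (ind k)) (ind k)) = 0"
        using 0 by (simp add: sum.reindex[OF inj])
      then have "(\<Sum>k\<in>?K. smult_matrix (f (ind k)) (ind k)) $ y $ z = 0" by (simp only: zero_index)
      then show "f N = 0" by (simp only: entry N)
    qed (use fin in simp)
    show "card (ind ` ?K) = card ?K" by (rule card_image[OF inj])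
  qed
qed

text \<open>Invariance of the entries under \<pi> means commuting with the permutation matrix of
  \<pi>, and such matrices form an algebra. For products the summation index is moved along the
  bijection.\<close>

lemma generated_subalgebra_invariant:
  assumes "M \<in> generated_subalgebra S" and "bij \<pi>"
    and "\<And>N y z. N \<in> S \<Longrightarrow> N $ \<pi> y $ \<pi> z = N $ y $ z"
  shows "M $ \<pi> y $ \<pi> z = M $ y $ z"
  using assms(1)
proof (induction arbitrary: y z)
  case one
  then show ?case using assms(2) by (simp add: Finite_Cartesian_Product.mat_def bij_is_inj inj_eq)
next
  case (mult M N)
  have "(M ** N) $ \<pi> y $ \<pi> z = (\<Sum>k\<in>UNIV. M $ \<pi> y $ \<pi> k * N $ \<pi> k $ \<pi> z)"
    using assms(2) by (simp add: matrix_matrix_mult_def sum.reindex_bij_betw[of \<pi> UNIV UNIV "\<lambda>k. M $ \<pi> y $ k * N $ k $ \<pi> z"])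
  also have "\<dots> = (M ** N) $ y $ z"
    by (simp add: mult.IH matrix_matrix_mult_def)
  finally show ?case .
qed (simp_all add: assms(3) smult_matrix_def)

lemma dual_idem_mult_matrix_nth:
  "(dual_idem E x i ** M) $ y $ z = (if gdist E x y = i then M $ y $ z else 0)"
  by (simp add: dual_idem_def matrix_matrix_mult_def if_distrib [of "\<lambda>t. t * _"]
      flip: if_if_eq_conj cong: if_cong)

lemma matrix_mult_dual_idem_nth:
  "(M ** dual_idem E x i) $ y $ z = (if gdist E x z = i then M $ y $ z else 0)"
proof -
  have "(M ** dual_idem E x i) $ y $ z = (\<Sum>k\<in>UNIV. if k = z then (if gdist E x z = i then M $ y $ z else 0) else 0)"
    unfolding matrix_matrix_mult_def dual_idem_def vec_lambda_beta by (rule sum.cong) auto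
  then show ?thesis by simp
qed

section \<open>The modules of a complete graph\<close>

context complete_graph_vertex
begin

abbreviation "A \<equiv> adjacency_matrix E"
abbreviation "T \<equiv> terwilliger_algebra E x"

definition primary_module :: "(complex^'x) set" where
  "primary_module = vec.span {estar E x 0, estar E x 1}"

text \<open>The orthogonal complement of \<open>primary_module\<close>, given by equations:
  orthogonality to \<open>estar E x 0\<close> says that the coordinate at \<open>x\<close> is 0, and
  orthogonality to \<open>estar E x 1\<close> then says that all coordinates sum to 0.\<close>

definition endpoint_1_space :: "(complex^'x) set" where
  "endpoint_1_space = {v. v $ x = 0 \<and> (\<Sum>y\<in>UNIV. v $ y) = 0}"

text \<open>In a complete graph \<open>A\<close> is the all-ones matrix minus the identity.\<close>

lemma adjacency_mult_nth: "(A *v w) $ y = (\<Sum>z\<in>UNIV. w $ z) - w $ y"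
proof -
  have "(A *v w) $ y = (\<Sum>z\<in>UNIV. w $ z - (if y = z then w $ z else 0))"
    unfolding matrix_vector_mult_def adjacency_matrix_def by (auto simp: adj_iff intro!: sum.cong)
  then show ?thesis by (simp add: sum_subtractf)
qed

lemma estar_nth: "estar E x 0 $ y = (if y = x then 1 else 0)"
  "estar E x 1 $ y = (if y = x then 0 else 1)"
  by (auto simp: estar_def gdist)

lemma sum_estar: "(\<Sum>y\<in>UNIV. estar E x 0 $ y) = 1"
  "(\<Sum>y\<in>UNIV. estar E x 1 $ y) = of_nat CARD('x) - 1"
proof -
  show "(\<Sum>y\<in>UNIV. estar E x 0 $ y) = 1" by (simp add: estar_nth)
  have "(\<Sum>y\<in>UNIV. estar E x 1 $ y) = (\<Sum>y\<in>UNIV. 1 - estar E x 0 $ y)"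
    by (rule sum.cong) (auto simp only: estar_nth split: if_splits, auto)
  then show "(\<Sum>y\<in>UNIV. estar E x 1 $ y) = of_nat CARD('x) - 1"
    by (simp add: sum_subtractf \<open>(\<Sum>y\<in>UNIV. estar E x 0 $ y) = 1\<close>)
qed

lemma adjacency_mult_estar:
  "A *v estar E x 0 = estar E x 1"
  "A *v estar E x 1 = (of_nat CARD('x) - 1) *s estar E x 0 + (of_nat CARD('x) - 2) *s estar E x 1"
  by (simp_all only: Finite_Cartesian_Product.vec_eq_iff adjacency_mult_nth sum_estar)
     (auto simp: estar_nth[unfolded One_nat_def])

lemma estar_nonzero: "estar E x 0 \<noteq> 0" "estar E x 1 \<noteq> 0"
proof -
  obtain z where "z \<noteq> x" using exists_other by blast
  then have "estar E x 0 $ x = 1" "estar E x 1 $ z = 1" by (simp_all add: estar_nth del: One_nat_def)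
  then show "estar E x 0 \<noteq> 0" "estar E x 1 \<noteq> 0" by (metis zero_index zero_neq_one)+
qed

lemma T_module_iff:
  "T_module T W \<longleftrightarrow> vec.subspace W \<and> (\<forall>w\<in>W. A *v w \<in> W) \<and>
     (\<forall>w\<in>W. dual_idem E x 0 *v w \<in> W) \<and> (\<forall>w\<in>W. dual_idem E x 1 *v w \<in> W)"
  unfolding terwilliger_module_iff_generators gdiam by (auto simp: le_Suc_eq)

lemma primary_module_T_module: "T_module T primary_module"
  unfolding T_module_iff primary_module_def
proof (intro conjI ballI)
  let ?S = "{estar E x 0, estar E x 1}"
  fix w assume w: "w \<in> vec.span ?S"
  show "A *v w \<in> vec.span ?S"
    using w
  proof (rule mult_span_subset[rotated])
    fix s assume "s \<in> ?S"
    then show "A *v s \<in> vec.span ?S"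
      by (elim insertE emptyE; simp only: adjacency_mult_estar)
        (intro vec.span_add vec.span_scale vec.span_base insertI1 insertI2)+
  qed
  show "dual_idem E x 0 *v w \<in> vec.span ?S" "dual_idem E x 1 *v w \<in> vec.span ?S"
    using w by (rule mult_span_subset[rotated]; auto simp: dual_idem_mult_estar intro: vec.span_base vec.span_zero)+
qed simp

lemma endpoint_1_space_mult:
  assumes "u \<in> endpoint_1_space"
  shows "A *v u = (-1) *s u" "dual_idem E x 0 *v u = 0 *s u" "dual_idem E x 1 *v u = 1 *s u"
  using assms
  by (auto simp: Finite_Cartesian_Product.vec_eq_iff adjacency_mult_nth dual_idem_mult_nth gdist endpoint_1_space_def)

text \<open>One scalar serves the whole space, because matrices acting on it by scalars are closed
  under the algebra operations. This uniformity makes all lines in the space isomorphic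
  modules.\<close>

lemma endpoint_1_space_scalar_action:
  assumes "B \<in> T"
  shows "\<exists>c. \<forall>u\<in>endpoint_1_space. B *v u = c *s u"
  using assms unfolding terwilliger_algebra_def gdiam
proof (induction rule: generated_subalgebra.induct)
  case (gen M)
  then have "M = A \<or> M = dual_idem E x 0 \<or> M = dual_idem E x 1"
    by (auto simp: le_Suc_eq)
  then show ?case using endpoint_1_space_mult by metis
next
  case one
  then show ?case by (metis matrix_vector_mul_lid vec.scale_one)
next
  case (add M N)
  then show ?case by (metis matrix_vector_mult_add_rdistrib vec.scale_left_distrib)
next
  case (scale M c)
  have "smult_matrix c M *v w = c *s (M *v w)" for w :: "complex^'x"
    by (simp add: smult_matrix_def matrix_vector_mult_def Finite_Cartesian_Product.vec_eq_iff
        sum_distrib_left mult_ac)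
  with scale show ?case by (metis vec.scale_scale)
next
  case (mult M N)
  then obtain c d where "\<forall>u\<in>endpoint_1_space. M *v u = c *s u" "\<forall>u\<in>endpoint_1_space. N *v u = d *s u" by blast
  then have "\<forall>u\<in>endpoint_1_space. (M ** N) *v u = (d * c) *s u"
    by (simp flip: matrix_vector_mul_assoc add: vec.scale)
  then show ?case by blast
qed

lemma span_endpoint_1_subset:
  assumes "u \<in> endpoint_1_space"
  shows "vec.span {u} \<subseteq> endpoint_1_space"
  using assms by (auto simp: vec.span_singleton endpoint_1_space_def simp flip: sum_distrib_left)

lemma endpoint_1_line_T_module:
  assumes "u \<in> endpoint_1_space"
  shows "T_module T (vec.span {u})"
  unfolding T_module_iff
  using endpoint_1_space_mult[OF subsetD[OF span_endpoint_1_subset[OF assms]]]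
  by (auto intro: vec.span_zero vec.span_neg simp del: One_nat_def)

lemma T_module_dichotomy:
  assumes "T_module T W"
  shows "primary_module \<subseteq> W \<or> W \<subseteq> endpoint_1_space"
proof (cases "\<exists>w\<in>W. w $ x \<noteq> 0")
  case True
  then obtain w where w: "w \<in> W" "w $ x \<noteq> 0" by blast
  have "estar E x 0 = (1 / w $ x) *s (dual_idem E x 0 *v w)"
    using w by (simp add: Finite_Cartesian_Product.vec_eq_iff dual_idem_mult_nth estar_nth gdist)
  then have e0: "estar E x 0 \<in> W"
    using assms w by (simp add: T_module_iff vec.subspace_scale)
  then have "estar E x 1 \<in> W"
    using assms adjacency_mult_estar(1) unfolding T_module_iff by metis
  then show ?thesis
    using e0 assms unfolding primary_module_def T_module_iff by (simp add: vec.span_minimal)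
next
  case False
  have "w \<in> endpoint_1_space" if "w \<in> W" for w
  proof -
    have "w $ x = 0" "(A *v w) $ x = 0" using assms False that by (auto simp: T_module_iff)
    then show ?thesis by (simp add: adjacency_mult_nth endpoint_1_space_def)
  qed
  then show ?thesis by blast
qed

lemma primary_orthogonal_endpoint_1:
  assumes "w \<in> primary_module" "u \<in> endpoint_1_space"
  shows "hermitian_inner w u = 0"
proof (rule hermitian_inner_span_left[OF _ assms(1)[unfolded primary_module_def]])
  have "hermitian_inner (estar E x 0) u = (\<Sum>y\<in>UNIV. if y = x then cnj (u $ y) else 0)"
    unfolding hermitian_inner_def estar_nth by (rule sum.cong) auto
  moreover have "hermitian_inner (estar E x 1) u = (\<Sum>y\<in>UNIV. cnj (u $ y) - (if y = x then cnj (u $ y) else 0))"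
    unfolding hermitian_inner_def estar_nth by (rule sum.cong) auto
  moreover have "(\<Sum>y\<in>UNIV. cnj (u $ y)) = 0"
    using assms(2) by (simp add: endpoint_1_space_def flip: cnj_sum)
  ultimately show "\<forall>w\<in>{estar E x 0, estar E x 1}. hermitian_inner w u = 0"
    using assms(2) by (simp add: endpoint_1_space_def sum_subtractf)
qed

lemma primary_inter_endpoint_1: "w \<in> primary_module \<Longrightarrow> w \<in> endpoint_1_space \<Longrightarrow> w = 0"
  using primary_orthogonal_endpoint_1 hermitian_inner_self_eq_0_iff by blast

lemma estar_in_primary: "estar E x 0 \<in> primary_module" "estar E x 1 \<in> primary_module"
  unfolding primary_module_def by (auto intro: vec.span_base)

lemma not_primary_subset_endpoint_1: "\<not> primary_module \<subseteq> endpoint_1_space"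
  using estar_in_primary(1) estar_nonzero(1) primary_inter_endpoint_1 by blast

text \<open>By \<open>T_module_dichotomy\<close> a proper submodule lies in
  \<open>endpoint_1_space\<close>, which meets \<open>primary_module\<close> only in 0.\<close>

lemma irreducible_primary_module: "irreducible_T_module T primary_module"
  unfolding irreducible_T_module_def
proof (intro conjI notI)
  show "T_module T primary_module" by (rule primary_module_T_module)
  show "primary_module = {0} \<Longrightarrow> False" using estar_in_primary(1) estar_nonzero(1) by auto
  assume "\<exists>W. T_module T W \<and> W \<noteq> {0} \<and> W \<subset> primary_module"
  then obtain W where W: "T_module T W" "W \<noteq> {0}" "W \<subset> primary_module" by blast
  then have "W \<subseteq> endpoint_1_space" using T_module_dichotomy by blast
  then have "W \<subseteq> {0}" using W(3) primary_inter_endpoint_1 by blast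
  moreover have "0 \<in> W" using W(1) by (simp add: T_module_def vec.subspace_0)
  ultimately show False using W(2) by blast
qed

lemma irreducible_endpoint_1_line:
  assumes "u \<in> endpoint_1_space" "u \<noteq> 0"
  shows "irreducible_T_module T (vec.span {u})"
  unfolding irreducible_T_module_def
proof (intro conjI notI)
  show "T_module T (vec.span {u})" using assms(1) by (rule endpoint_1_line_T_module)
  show "vec.span {u} = {0} \<Longrightarrow> False" using span_singleton_nonzero[OF assms(2)] by contradiction
  assume "\<exists>W. T_module T W \<and> W \<noteq> {0} \<and> W \<subset> vec.span {u}"
  then obtain W where W: "T_module T W" "W \<noteq> {0}" "W \<subset> vec.span {u}" by blast
  have sub: "vec.subspace W" using W(1) by (simp add: T_module_def)
  then have "0 \<in> W" by (rule vec.subspace_0)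
  with W(2) obtain w where w: "w \<in> W" "w \<noteq> 0" by blast
  then obtain k where k: "w = k *s u" using W(3) by (auto simp: vec.span_singleton)
  with w have "u = (1 / k) *s w" by auto
  then have "u \<in> W" using sub w(1) by (simp add: vec.subspace_scale)
  then have "vec.span {u} \<subseteq> W" using sub by (simp add: vec.span_minimal)
  then show False using W(3) by blast
qed

text \<open>Irreducibility forces equality with any nonzero submodule: with
  \<open>primary_module\<close> if \<open>W\<close> contains it, and otherwise with the line through
  any nonzero vector of \<open>W\<close>.\<close>

lemma irreducible_cases:
  assumes "irreducible_T_module T W"
  obtains "W = primary_module"
  | u where "u \<in> endpoint_1_space" "u \<noteq> 0" "W = vec.span {u}"
proof -
  have W: "T_module T W" "W \<noteq> {0}" and minimal: "\<And>U. T_module T U \<Longrightarrow> U \<noteq> {0} \<Longrightarrow> U \<subseteq> W \<Longrightarrow> U = W"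
    using assms unfolding irreducible_T_module_def by blast+
  from W(1) have sub: "vec.subspace W" by (simp add: T_module_def)
  from T_module_dichotomy[OF W(1)] show thesis
  proof
    assume "primary_module \<subseteq> W"
    then have "primary_module = W"
      using minimal primary_module_T_module irreducible_primary_module
      unfolding irreducible_T_module_def by blast
    then show thesis using that(1) by blast
  next
    assume U: "W \<subseteq> endpoint_1_space"
    have "0 \<in> W" using sub by (rule vec.subspace_0)
    with W(2) obtain u where u: "u \<in> W" "u \<noteq> 0" by blast
    then have "u \<in> endpoint_1_space" using U by blast
    then have "vec.span {u} = W"
      using u sub by (intro minimal endpoint_1_line_T_module span_singleton_nonzero) (simp_all add: vec.span_minimal)
    then show thesis using that(2) \<open>u \<in> endpoint_1_space\<close> u(2) by blast
  qed
qed

text \<open>The matrix \<open>dual_idem E x 0\<close> separates the two types: it kills the line but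
  fixes \<open>estar E x 0\<close>.\<close>

lemma not_isomorphic_primary_line:
  assumes "u \<in> endpoint_1_space"
  shows "\<not> T_isomorphic T primary_module (vec.span {u})" "\<not> T_isomorphic T (vec.span {u}) primary_module"
proof -
  have E0: "dual_idem E x 0 \<in> T"
    unfolding terwilliger_algebra_def by (rule generated_subalgebra.gen) simp
  have "\<forall>w\<in>vec.span {u}. dual_idem E x 0 *v w = 0"
    using span_endpoint_1_subset[OF assms] endpoint_1_space_mult(2) by (auto simp: subset_iff)
  moreover have "dual_idem E x 0 *v estar E x 0 \<noteq> 0"
    using estar_nonzero by (simp add: dual_idem_mult_estar)
  then have "\<not> (\<forall>w\<in>primary_module. dual_idem E x 0 *v w = 0)"
    using estar_in_primary(1) by blast
  ultimately show "\<not> T_isomorphic T primary_module (vec.span {u})" "\<not> T_isomorphic T (vec.span {u}) primary_module"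
    using T_isomorphic_kernel_iff[OF _ primary_module_T_module E0]
      T_isomorphic_kernel_iff[OF _ endpoint_1_line_T_module[OF assms] E0] by metis+
qed

lemma endpoint_1_lines_isomorphic:
  assumes "u \<in> endpoint_1_space" "u \<noteq> 0" "v \<in> endpoint_1_space" "v \<noteq> 0"
  shows "T_isomorphic T (vec.span {u}) (vec.span {v})"
proof (rule T_isomorphic_lines[OF assms(2,4)], rule ballI)
  fix B assume "B \<in> T"
  then obtain c where "\<forall>u\<in>endpoint_1_space. B *v u = c *s u"
    using endpoint_1_space_scalar_action by blast
  then show "\<exists>c. B *v u = c *s u \<and> B *v v = c *s v" using assms(1,3) by blast
qed

text \<open>Together with the analogue for lines, this replaces the isomorphism test in
  \<open>T_multiplicity\<close> by a comparison with \<open>primary_module\<close>, so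
  multiplicities become counts of list entries.\<close>

lemma primary_isomorphic_iff:
  assumes "irreducible_T_module T W"
  shows "T_isomorphic T primary_module W \<longleftrightarrow> W = primary_module"
  using assms
proof (cases rule: irreducible_cases)
  case (2 u)
  then show ?thesis
    using not_isomorphic_primary_line(1) T_isomorphic_refl by metis
qed (simp add: T_isomorphic_refl)

lemma endpoint_1_line_isomorphic_iff:
  assumes "irreducible_T_module T W" "u \<in> endpoint_1_space" "u \<noteq> 0"
  shows "T_isomorphic T (vec.span {u}) W \<longleftrightarrow> W \<noteq> primary_module"
  using assms(1)
proof (cases rule: irreducible_cases)
  case (2 v)
  then have "W \<noteq> primary_module"
    using span_endpoint_1_subset not_primary_subset_endpoint_1 by blast
  with 2 show ?thesis using endpoint_1_lines_isomorphic assms(2,3) by blast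
qed (use assms(2) in \<open>simp add: not_isomorphic_primary_line\<close>)

lemma estar_independent: "vec.independent {estar E x 0, estar E x 1}"
  and estar_distinct: "estar E x 0 \<noteq> estar E x 1"
proof -
  have *: "(k *s estar E x 1) $ x = 0" for k by (simp add: estar_nth del: One_nat_def)
  have 1: "estar E x 0 $ x = 1" by (simp add: estar_nth)
  have "estar E x 0 \<notin> vec.span {estar E x 1}"
    using * 1 unfolding vec.span_singleton by (metis imageE zero_neq_one)
  moreover have "vec.independent {estar E x 1}" using estar_nonzero(2) by simp
  ultimately show "vec.independent {estar E x 0, estar E x 1}" "estar E x 0 \<noteq> estar E x 1"
    by (auto simp: vec.independent_insert intro: vec.span_base)
qed

lemma dim_primary_module: "vec.dim primary_module = 2"
  unfolding primary_module_def vec.dim_span_eq_card_independent[OF estar_independent]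
  using estar_distinct by simp

section \<open>Multiplicities in an arbitrary orthogonal decomposition\<close>

text \<open>Without \<open>primary_module\<close> the summands would all lie in
  \<open>endpoint_1_space\<close>, a proper subspace; with two copies of it
  \<open>estar E x 0\<close> would be orthogonal to itself. The other summands are lines, so their
  number is the total dimension minus 2.\<close>

lemma orthogonal_decomposition_counts:
  assumes "orthogonal_decomposition T Ws"
  shows "length (filter (\<lambda>W. W = primary_module) Ws) = 1"
    and "length (filter (\<lambda>W. W \<noteq> primary_module) Ws) = CARD('x) - 2"
proof -
  let ?P = "filter (\<lambda>W. W = primary_module) Ws" and ?Q = "filter (\<lambda>W. W \<noteq> primary_module) Ws"
  have irr: "\<And>W. W \<in> set Ws \<Longrightarrow> irreducible_T_module T W"
    and orth: "\<And>i j. i < length Ws \<Longrightarrow> j < length Ws \<Longrightarrow> i \<noteq> j \<Longrightarrow>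
        \<forall>u\<in>Ws ! i. \<forall>v\<in>Ws ! j. hermitian_inner u v = 0"
    and span: "vec.span (\<Union> (set Ws)) = UNIV"
    using assms unfolding orthogonal_decomposition_def by auto
  have line: "\<exists>u. u \<in> endpoint_1_space \<and> u \<noteq> 0 \<and> W = vec.span {u}"
    if "W \<in> set Ws" "W \<noteq> primary_module" for W
    using irr[OF that(1)] that(2) by (cases rule: irreducible_cases) auto
  have "?P \<noteq> []"
  proof
    assume "?P = []"
    then have "\<Union> (set Ws) \<subseteq> endpoint_1_space"
      using line span_endpoint_1_subset by (fastforce simp: filter_empty_conv)
    moreover have "vec.subspace endpoint_1_space"
      by (auto simp: endpoint_1_space_def vec.subspace_def sum.distrib simp flip: sum_distrib_left)
    ultimately have "UNIV \<subseteq> endpoint_1_space"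
      using span vec.span_minimal by metis
    then show False using not_primary_subset_endpoint_1 by blast
  qed
  \<comment> \<open>Positions are counted because a list may repeat a summand.\<close>
  moreover have "card {i. i < length Ws \<and> Ws ! i = primary_module} \<le> 1"
  proof -
    have "i = j" if "i < length Ws" "Ws ! i = primary_module" "j < length Ws" "Ws ! j = primary_module" for i j
      using orth[of i j] that estar_in_primary(1) estar_nonzero(1) hermitian_inner_self_eq_0_iff by metis
    then show ?thesis by (simp add: card_le_Suc0_iff_eq)
  qed
  then have "length ?P \<le> 1" by (simp add: length_filter_conv_card)
  ultimately show P: "length ?P = 1" by (simp add: le_Suc_eq)
  have "sum_list (map vec.dim Ws) = sum_list (map vec.dim ?P) + sum_list (map vec.dim ?Q)"
    by (induction Ws) auto
  moreover have "map vec.dim ?P = map (\<lambda>_. 2) ?P"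
    by (rule map_cong) (auto simp: dim_primary_module)
  moreover have "map vec.dim ?Q = map (\<lambda>_. 1) ?Q"
    by (rule map_cong) (use line in \<open>fastforce simp: vec.dim_span\<close>)+
  moreover have "sum_list (map vec.dim Ws) = CARD('x)"
  proof -
    have "\<forall>W\<in>set Ws. vec.subspace W" using irr by (auto simp: irreducible_T_module_def T_module_def)
    then show ?thesis
      using dim_span_orthogonal_subspaces[of Ws] orth span by (simp add: card_cart_basis)
  qed
  ultimately show "length ?Q = CARD('x) - 2" using P by (simp add: sum_list_triv)
qed

text \<open>The given decomposition supplies existence for \<open>THE\<close>; uniqueness holds
  because the count is the same in every decomposition.\<close>

lemma primary_multiplicity:
  assumes "orthogonal_decomposition T Ws"
  shows "T_multiplicity T primary_module = 1"
proof -
  have "length (filter (T_isomorphic T primary_module) Vs) = 1" if "orthogonal_decomposition T Vs" for Vs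
  proof -
    have "filter (T_isomorphic T primary_module) Vs = filter (\<lambda>W. W = primary_module) Vs"
      using that by (intro filter_cong) (auto simp: orthogonal_decomposition_def primary_isomorphic_iff)
    then show ?thesis using orthogonal_decomposition_counts(1)[OF that] by simp
  qed
  then show ?thesis unfolding T_multiplicity_def using assms by (intro the_equality) auto
qed

lemma endpoint_1_line_multiplicity:
  assumes "orthogonal_decomposition T Ws" "u \<in> endpoint_1_space" "u \<noteq> 0"
  shows "T_multiplicity T (vec.span {u}) = CARD('x) - 2"
proof -
  have "length (filter (T_isomorphic T (vec.span {u})) Vs) = CARD('x) - 2"
    if "orthogonal_decomposition T Vs" for Vs
  proof -
    have "filter (T_isomorphic T (vec.span {u})) Vs = filter (\<lambda>W. W \<noteq> primary_module) Vs"
      using that assms(2,3) by (intro filter_cong) (auto simp: orthogonal_decomposition_def endpoint_1_line_isomorphic_iff)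
    then show ?thesis using orthogonal_decomposition_counts(2)[OF that] by simp
  qed
  then show ?thesis unfolding T_multiplicity_def using assms by (intro the_equality) auto
qed

section \<open>Endpoints, diameters, shapes and pure bases\<close>

lemma primary_components:
  "component E x 0 primary_module = vec.span {estar E x 0}"
  "component E x 1 primary_module = vec.span {estar E x 1}"
  unfolding primary_module_def component_span by (simp_all add: dual_idem_mult_estar insert_commute)

lemma endpoint_1_line_components:
  assumes "u \<in> endpoint_1_space"
  shows "component E x 0 (vec.span {u}) = {0}" "component E x 1 (vec.span {u}) = vec.span {u}"
  unfolding component_span using endpoint_1_space_mult[OF assms] by simp_all

lemma module_support_eq:
  "module_support E x W = {i \<in> {0, 1}. component E x i W \<noteq> {0}}"
proof -
  have "i \<le> gdiam E \<longleftrightarrow> i \<in> {0, 1}" for i by (auto simp: gdiam)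
  then show ?thesis by (simp only: module_support_def)
qed

lemma primary_support: "module_support E x primary_module = {0, 1}"
proof -
  have "component E x i primary_module \<noteq> {0}" if "i \<in> {0, 1}" for i
    using that span_singleton_nonzero[OF estar_nonzero(1)] span_singleton_nonzero[OF estar_nonzero(2)]
    by (elim insertE emptyE) (simp_all only: primary_components not_False_eq_True)
  then show ?thesis unfolding module_support_eq by blast
qed

lemma endpoint_1_line_support:
  assumes "u \<in> endpoint_1_space" "u \<noteq> 0"
  shows "module_support E x (vec.span {u}) = {1}"
proof -
  have "component E x 1 (vec.span {u}) \<noteq> {0}"
    unfolding endpoint_1_line_components[OF assms(1)] by (rule span_singleton_nonzero[OF assms(2)])
  then show ?thesis
    unfolding module_support_eq using endpoint_1_line_components(1)[OF assms(1)] by blast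
qed

lemma primary_data:
  "module_endpoint E x primary_module = 0"
  "module_diameter E x primary_module = 1"
  "module_shape E x primary_module = [1, 1]"
proof -
  show *: "module_endpoint E x primary_module = 0" "module_diameter E x primary_module = 1"
    by (simp_all add: module_endpoint_def module_diameter_def primary_support)
  show "module_shape E x primary_module = [1, 1]"
    using estar_nonzero unfolding module_shape_def *
    by (simp add: primary_components primary_components[unfolded One_nat_def])
qed

lemma endpoint_1_line_data:
  assumes "u \<in> endpoint_1_space" "u \<noteq> 0"
  shows "module_endpoint E x (vec.span {u}) = 1"
    "module_diameter E x (vec.span {u}) = 0"
    "module_shape E x (vec.span {u}) = [1]"
proof -
  show *: "module_endpoint E x (vec.span {u}) = 1" "module_diameter E x (vec.span {u}) = 0"
    using assms by (simp_all add: module_endpoint_def module_diameter_def endpoint_1_line_support)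
  show "module_shape E x (vec.span {u}) = [1]"
    using assms unfolding module_shape_def *
    by (simp add: endpoint_1_line_components[unfolded One_nat_def])
qed

lemma pure_basis_primary: "pure_basis E x primary_module [estar E x 0, estar E x 1]"
  unfolding pure_basis_def ordered_basis_def
proof (intro conjI exI[of _ "[0, 1]"])
  show "list_all2 (pure_vector E x) [0, 1] [estar E x 0, estar E x 1]"
    using estar_nonzero by (simp add: pure_vector_iff dual_idem_mult_estar)
qed (use estar_independent estar_distinct in \<open>simp_all add: primary_module_def\<close>)

lemma pure_vector_endpoint_1: "u \<in> endpoint_1_space \<Longrightarrow> u \<noteq> 0 \<Longrightarrow> pure_vector E x 1 u"
  using endpoint_1_space_mult(3)[of u] by (simp add: pure_vector_iff)

lemma pure_basis_endpoint_1_line: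
  assumes "u \<in> endpoint_1_space" "u \<noteq> 0"
  shows "pure_basis E x (vec.span {u}) [u]"
  unfolding pure_basis_def ordered_basis_def
  using pure_vector_endpoint_1[OF assms] assms(2) by (auto intro!: exI[of _ "[1]"])

section \<open>The dimension of the Terwilliger algebra\<close>

text \<open>The three truth values label the orbit of the pair \<open>(y, z)\<close> under the
  permutations fixing \<open>x\<close>.\<close>

lemma terwilliger_algebra_eq:
  "T = {M. \<exists>f. \<forall>y z. M $ y $ z = f (y = x, z = x, y = z)}" (is "_ = ?C")
proof
  show "T \<subseteq> ?C"
  proof
    fix M assume M: "M \<in> T"
    have inv: "M $ \<pi> y $ \<pi> z = M $ y $ z" if "bij \<pi>" "\<pi> x = x" for \<pi> y z
    proof (rule generated_subalgebra_invariant[OF M[unfolded terwilliger_algebra_def] that(1)])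
      have eq: "\<pi> a = \<pi> b \<longleftrightarrow> a = b" for a b using that(1) by (simp add: bij_is_inj inj_eq)
      moreover have "gdist E x (\<pi> a) = gdist E x a" for a using eq[of x a] that(2) by (simp add: gdist)
      ultimately show "N $ \<pi> y $ \<pi> z = N $ y $ z"
        if "N \<in> insert A (dual_idem E x ` {0..gdiam E})" for N y z
        using that by (elim insertE imageE) (simp_all add: adjacency_matrix_def dual_idem_def adj_iff)
    qed
    have "M $ y $ z = M $ y' $ z'"
      if "(y = x, z = x, y = z) = (y' = x, z' = x, y' = z')" for y z y' z'
    proof -
      have "\<exists>\<pi>. bij \<pi> \<and> \<pi> x = x \<and> \<pi> y = y' \<and> \<pi> z = z'"
      proof -
        \<comment> \<open>First \<open>y\<close> is moved to \<open>y'\<close>; then \<tau> moves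
          the image of \<open>z\<close> to \<open>z'\<close>. Equal labels guarantee that
          \<open>\<sigma> z\<close> is \<open>x\<close> or \<open>y'\<close> exactly when
          \<open>z'\<close> is, so \<tau> disturbs neither \<open>x\<close> nor
          \<open>y'\<close>.\<close>
        define \<sigma> where "\<sigma> = Transposition.transpose y y'"
        define \<tau> where "\<tau> = Transposition.transpose (\<sigma> z) z'"
        have cls: "y = x \<longleftrightarrow> y' = x" "z = x \<longleftrightarrow> z' = x" "y = z \<longleftrightarrow> y' = z'"
          using that by blast+
        have \<sigma>: "inj \<sigma>" "\<sigma> y = y'" by (simp_all add: \<sigma>_def)
        have \<sigma>x: "\<sigma> x = x"
          using cls(1) by (cases "y = x") (simp_all add: \<sigma>_def)
        have "\<sigma> z = x \<longleftrightarrow> z' = x" "\<sigma> z = y' \<longleftrightarrow> z' = y'"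
          using inj_eq[OF \<sigma>(1), of z x] inj_eq[OF \<sigma>(1), of z y] \<sigma>(2) \<sigma>x cls by metis+
        then have "\<tau> x = x" "\<tau> y' = y'" "\<tau> (\<sigma> z) = z'"
          unfolding \<tau>_def Transposition.transpose_def by metis+
        moreover have "bij (\<tau> \<circ> \<sigma>)" by (simp add: \<sigma>_def \<tau>_def bij_comp)
        ultimately show ?thesis using \<sigma>(2) \<sigma>x by (metis comp_apply)
      qed
      then show ?thesis using inv by metis
    qed
    \<comment> \<open>The function of the label is built by choosing an entry with that label; all
      such entries agree, so the choice returns the right value.\<close>
    then have "M $ y $ z = (\<lambda>k. SOME c. \<exists>y' z'. (y' = x, z' = x, y' = z') = k \<and> c = M $ y' $ z') (y = x, z = x, y = z)"
      for y z by (intro some_equality[symmetric]) blast+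
    then show "M \<in> ?C" by (intro CollectI exI allI)
  qed
  show "?C \<subseteq> T"
  proof
    fix M assume "M \<in> ?C"
    then obtain f where M: "M $ y $ z = f (y = x, z = x, y = z)" for y z by auto
    let ?E0 = "dual_idem E x 0" and ?E1 = "dual_idem E x 1"
    \<comment> \<open>The five matrices are the orbit indicators: the entry at
      \<open>(x, x)\<close>, the rest of the diagonal, the rest of row \<open>x\<close>, the rest of
      column \<open>x\<close>, and the off-diagonal entries among the other vertices.\<close>
    have "M = smult_matrix (f (True, True, True)) ?E0 + smult_matrix (f (False, False, True)) ?E1
        + smult_matrix (f (True, False, False)) (?E0 ** A ** ?E1)
        + smult_matrix (f (False, True, False)) (?E1 ** A ** ?E0)
        + smult_matrix (f (False, False, False)) (?E1 ** A ** ?E1)"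
      (is "M = ?N")
    proof -
      have "M $ y $ z = ?N $ y $ z" for y z
        by (cases "y = x"; cases "z = x"; cases "y = z")
           (simp_all add: M smult_matrix_def matrix_mult_dual_idem_nth dual_idem_mult_matrix_nth,
            simp_all add: gdist dual_idem_def adjacency_matrix_def adj_iff)
      then show ?thesis by (intro Finite_Cartesian_Product.vec_eq_iff[THEN iffD2] allI)
    qed
    also have "\<dots> \<in> T"
    proof -
      have "?E0 \<in> T" "?E1 \<in> T" "A \<in> T"
        unfolding terwilliger_algebra_def gdiam by (auto intro!: generated_subalgebra.gen)
      then show ?thesis
        unfolding terwilliger_algebra_def
        by (intro generated_subalgebra.add generated_subalgebra.scale generated_subalgebra.mult)
    qed
    finally show "M \<in> T" .
  qed
qed

text \<open>Of the eight conceivable labels five occur. The label with all components false requires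
  two distinct vertices besides \<open>x\<close>, whence the bound 3.\<close>

lemma dim_terwilliger_algebra:
  assumes "3 \<le> CARD('x)"
  shows "matrix_vs.dim T = 5"
proof -
  obtain a where a: "a \<noteq> x" using exists_other by blast
  have "card {x, a} < CARD('x)" using a assms by simp
  then have "{x, a} \<noteq> UNIV" by (metis less_irrefl)
  then obtain b where ab: "a \<noteq> x" "b \<noteq> x" "a \<noteq> b" using a by blast
  have "range (\<lambda>(y, z). (y = x, z = x, y = z)) = {(True, True, True), (True, False, False),
      (False, True, False), (False, False, True), (False, False, False)}" (is "?R = ?S")
  proof
    show "?R \<subseteq> ?S" by auto
    have mem: "k \<in> ?R" if "(y = x, z = x, y = z) = k" for y z k
      using that by (intro image_eqI[of _ _ "(y, z)"]) simp_all
    have "(True, True, True) \<in> ?R" by (rule mem[of x x]) simp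
    moreover have "(True, False, False) \<in> ?R" by (rule mem[of x a]) (use ab in simp)
    moreover have "(False, True, False) \<in> ?R" by (rule mem[of a x]) (use ab in simp)
    moreover have "(False, False, True) \<in> ?R" by (rule mem[of a a]) (use ab in simp)
    moreover have "(False, False, False) \<in> ?R" by (rule mem[of a b]) (use ab in simp)
    ultimately show "?S \<subseteq> ?R" by (simp only: insert_subset empty_subsetI simp_thms)
  qed
  then show ?thesis
    unfolding terwilliger_algebra_eq dim_class_function_matrices[of "\<lambda>y z. (y = x, z = x, y = z)"]
    by (simp only:) simp
qed

section \<open>Representing matrices and the decomposition for four vertices\<close>

lemma represents_primary:
  assumes "CARD('x) = 4"
  shows "represents_wrt (mat_of_rows_list 2 [[0, 3], [1, 2]]) A [estar E x 0, estar E x 1]"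
  unfolding represents_wrt_def
proof (intro conjI allI impI)
  show "mat_of_rows_list 2 [[0, 3], [1, 2 :: complex]]
      \<in> carrier_mat (length [estar E x 0, estar E x 1]) (length [estar E x 0, estar E x 1])"
    by (auto simp: mat_of_rows_list_def)
  fix j assume "j < length [estar E x 0, estar E x 1]"
  then have "j = 0 \<or> j = 1" by auto
  then show "A *v ([estar E x 0, estar E x 1] ! j) =
      (\<Sum>i<length [estar E x 0, estar E x 1].
         mat_of_rows_list 2 [[0, 3], [1, 2]] $$ (i, j) *s [estar E x 0, estar E x 1] ! i)"
    using adjacency_mult_estar assms
    by (elim disjE) (simp_all add: mat_of_rows_list_def)
qed

lemma represents_endpoint_1:
  assumes "u \<in> endpoint_1_space"
  shows "represents_wrt (mat_of_rows_list 1 [[-1]]) A [u]"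
  using endpoint_1_space_mult(1)[OF assms]
  unfolding represents_wrt_def by (auto simp: mat_of_rows_list_def)

text \<open>The summands are pairwise orthogonal of dimensions 2, 1 and 1, so their span has
  dimension 4 and is the whole standard module.\<close>

lemma orthogonal_decomposition_4:
  assumes "CARD('x) = 4" "u \<in> endpoint_1_space" "u \<noteq> 0" "v \<in> endpoint_1_space" "v \<noteq> 0"
    and "hermitian_inner u v = 0"
  shows "orthogonal_decomposition T [primary_module, vec.span {u}, vec.span {v}]" (is "orthogonal_decomposition _ ?Ws")
proof -
  have irr: "\<forall>W\<in>set ?Ws. irreducible_T_module T W"
    using assms irreducible_primary_module irreducible_endpoint_1_line by auto
  have comm: "hermitian_inner b a = cnj (hermitian_inner a b)" for a b :: "complex^'x"
    by (simp add: hermitian_inner_def mult.commute)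
  have 1: "hermitian_inner a b = 0" if "a \<in> primary_module" "b \<in> vec.span {u} \<union> vec.span {v}" for a b
  proof -
    have "b \<in> endpoint_1_space"
      using that(2) span_endpoint_1_subset[OF assms(2)] span_endpoint_1_subset[OF assms(4)] by auto
    with that(1) show ?thesis by (rule primary_orthogonal_endpoint_1)
  qed
  have 2: "hermitian_inner a b = 0" if "a \<in> vec.span {u}" "b \<in> vec.span {v}" for a b
  proof (rule hermitian_inner_span_left[OF _ that(1)], rule ballI)
    fix w assume "w \<in> {u}"
    then show "hermitian_inner w b = 0"
      using assms(6) by (intro hermitian_inner_span_right[OF _ that(2)]) simp
  qed
  have orth: "\<forall>i<length ?Ws. \<forall>j<length ?Ws. i \<noteq> j \<longrightarrow> (\<forall>a\<in>?Ws ! i. \<forall>b\<in>?Ws ! j. hermitian_inner a b = 0)"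
  proof (intro allI impI ballI)
    fix i j a b
    assume *: "i < length ?Ws" "j < length ?Ws" "i \<noteq> j" and ab: "a \<in> ?Ws ! i" "b \<in> ?Ws ! j"
    have "i = 0 \<or> i = 1 \<or> i = 2" "j = 0 \<or> j = 1 \<or> j = 2" using * by auto
    \<comment> \<open>Orthogonality is known in only one order for each pair; conjugate symmetry
      settles the other.\<close>
    with ab *(3) have "hermitian_inner a b = 0 \<or> hermitian_inner b a = 0"
      using 1 2 by (elim disjE) simp_all
    then show "hermitian_inner a b = 0" using comm by (metis complex_cnj_zero)
  qed
  have sub: "\<forall>W\<in>set ?Ws. vec.subspace W" using irr by (auto simp: irreducible_T_module_def T_module_def)
  have "vec.dim (vec.span (\<Union> (set ?Ws))) = CARD('x)"
    unfolding dim_span_orthogonal_subspaces[OF sub orth]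
    using assms by (simp add: dim_primary_module)
  also have "\<dots> = vec.dim (UNIV :: (complex^'x) set)" by (simp add: card_cart_basis)
  finally have "vec.span (\<Union> (set ?Ws)) = UNIV"
    by (intro vec.subspace_dim_equal) simp_all
  with irr orth show ?thesis unfolding orthogonal_decomposition_def by blast
qed

end

theorem mainTheorem1:
  fixes E :: "'x::finite \<Rightarrow> 'x \<Rightarrow> bool" and x :: 'x and ys :: "'x list"
  defines "A \<equiv> adjacency_matrix E"
  defines "T \<equiv> terwilliger_algebra E x"
  defines "B0 \<equiv> mat_of_rows_list 2 [[0, 3], [1, 2]]"
  defines "B1 \<equiv> mat_of_rows_list 1 [[-1]]"
  assumes "CARD('x) = 4" and "complete_graph E"
  assumes "distinct ys" and "set ys = gsphere E 1 x"
  shows "(\<forall>F :: 'x \<Rightarrow> 'x \<Rightarrow> bool.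
            distance_regular F \<and> intersection_array F = ([3], [1]) \<longleftrightarrow> F = E)
       \<and> spectrum_mset A = {#3#} + replicate_mset 3 (-1)
       \<and> (\<exists>W0 W1a W1b \<nu>a \<nu>b.
            orthogonal_decomposition T [W0, W1a, W1b]
          \<and> (\<forall>i<3. \<forall>j<3. T_isomorphic T ([W0, W1a, W1b] ! i) ([W0, W1a, W1b] ! j)
                \<longleftrightarrow> [1, 2, 2 :: nat] ! i = [1, 2, 2] ! j)
          \<and> module_endpoint E x W0 = 0
          \<and> T_multiplicity T W0 = 1
          \<and> vec.dim W0 = 2
          \<and> module_diameter E x W0 = 1
          \<and> module_shape E x W0 = [1, 1]
          \<and> pure_basis E x W0 [estar E x 0, estar E x 1]
          \<and> represents_wrt B0 A [estar E x 0, estar E x 1]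
          \<and> proots (char_poly B0) = {#3, -1#}
          \<and> essential_part ys \<nu>a = [1, -1, 0]
          \<and> essential_part ys \<nu>b = [1, 1, -2]
          \<and> (\<forall>(W, \<nu>) \<in> {(W1a, \<nu>a), (W1b, \<nu>b)}.
                module_endpoint E x W = 1
              \<and> T_multiplicity T W = 2
              \<and> vec.dim W = 1
              \<and> module_diameter E x W = 0
              \<and> module_shape E x W = [1]
              \<and> pure_vector E x (module_endpoint E x W) \<nu>
              \<and> vec.span {\<nu>} = component E x (module_endpoint E x W) W
              \<and> vec.dim (component E x (module_endpoint E x W) W) = 1
              \<and> pure_basis E x W [\<nu>]
              \<and> represents_wrt B1 A [\<nu>]
              \<and> proots (char_poly B1) = {#-1#}))
       \<and> matrix_vs.dim T = 2^2 + 1^2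
       \<and> matrix_vs.dim T = 5"
proof -
  interpret complete_graph_vertex E x
    by unfold_locales (use assms(5,6) in simp_all)
  have "card (set ys) = 3"
    using assms(5) by (simp add: assms(8) gsphere_1[unfolded One_nat_def] Compl_eq_Diff_UNIV card_Diff_subset)
  then have "length ys = 3" using assms(7) by (simp add: distinct_card)
  then obtain a b c where ys: "ys = [a, b, c]"
    by (auto simp: numeral_3_eq_3 length_Suc_conv)
  have abc: "a \<noteq> b" "b \<noteq> a" "a \<noteq> c" "c \<noteq> a" "b \<noteq> c" "c \<noteq> b"
    and x: "a \<noteq> x" "b \<noteq> x" "c \<noteq> x" "x \<noteq> a" "x \<noteq> b" "x \<noteq> c"
    and UNIV: "(UNIV :: 'x set) = {x, a, b, c}"
    using assms(7,8) ys gsphere_1[of x] by auto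
  \<comment> \<open>The seed vectors, with coordinates [1, -1, 0] and [1, 1, -2] along
    \<open>ys\<close>. Both have coordinate sum 0 and vanish at \<open>x\<close>, and they are
    orthogonal since 1 - 1 + 0 = 0.\<close>
  define u v :: "complex^'x"
    where "u = (\<chi> y. if y = a then 1 else if y = b then -1 else 0)"
      and "v = (\<chi> y. if y = a then 1 else if y = b then 1 else if y = c then -2 else 0)"
  have u: "u \<in> endpoint_1_space" "u \<noteq> 0" and v: "v \<in> endpoint_1_space" "v \<noteq> 0"
  proof -
    show "u \<in> endpoint_1_space" "v \<in> endpoint_1_space"
      using abc x by (simp_all add: u_def v_def endpoint_1_space_def UNIV)
    have "u $ a = 1" "v $ a = 1" by (simp_all add: u_def v_def)
    then show "u \<noteq> 0" "v \<noteq> 0" by (metis zero_index zero_neq_one)+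
  qed
  have uv: "hermitian_inner u v = 0"
    using abc x by (simp add: hermitian_inner_def u_def v_def UNIV)
  have ess: "essential_part ys u = [1, -1, 0]" "essential_part ys v = [1, 1, -2]"
    using abc by (simp_all add: essential_part_def ys u_def v_def)
  let ?W0 = primary_module and ?Wa = "vec.span {u}" and ?Wb = "vec.span {v}"
  have dec: "orthogonal_decomposition T [?W0, ?Wa, ?Wb]"
    unfolding T_def using assms(5) u v uv by (rule orthogonal_decomposition_4)
  have iso: "\<forall>i<3. \<forall>j<3. T_isomorphic T ([?W0, ?Wa, ?Wb] ! i) ([?W0, ?Wa, ?Wb] ! j)
                \<longleftrightarrow> [1, 2, 2 :: nat] ! i = [1, 2, 2] ! j"
  proof (intro allI impI)
    fix i j :: nat assume "i < 3" "j < 3"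
    then have "i = 0 \<or> i = 1 \<or> i = 2" "j = 0 \<or> j = 1 \<or> j = 2" by auto
    then show "T_isomorphic T ([?W0, ?Wa, ?Wb] ! i) ([?W0, ?Wa, ?Wb] ! j)
                \<longleftrightarrow> [1, 2, 2 :: nat] ! i = [1, 2, 2] ! j"
      unfolding T_def
      by (elim disjE) (simp_all add: T_isomorphic_refl not_isomorphic_primary_line endpoint_1_lines_isomorphic u v)
  qed
  \<comment> \<open>Both summands of type II are treated at once: the data hold for the line through
    any nonzero \<open>w\<close> in \<open>endpoint_1_space\<close>, and the multiplicity is 4 -
    2.\<close>
  have line: "module_endpoint E x (vec.span {w}) = 1
              \<and> T_multiplicity T (vec.span {w}) = 2
              \<and> vec.dim (vec.span {w}) = 1
              \<and> module_diameter E x (vec.span {w}) = 0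
              \<and> module_shape E x (vec.span {w}) = [1]
              \<and> pure_vector E x (module_endpoint E x (vec.span {w})) w
              \<and> vec.span {w} = component E x (module_endpoint E x (vec.span {w})) (vec.span {w})
              \<and> vec.dim (component E x (module_endpoint E x (vec.span {w})) (vec.span {w})) = 1
              \<and> pure_basis E x (vec.span {w}) [w]
              \<and> represents_wrt B1 A [w]
              \<and> proots (char_poly B1) = {#-1#}"
    if w: "w \<in> endpoint_1_space" "w \<noteq> 0" for w
    unfolding endpoint_1_line_data[OF w] endpoint_1_line_components[OF w(1)] B1_def A_def T_def
      endpoint_1_line_multiplicity[OF dec[unfolded T_def] w] assms(5)
    using pure_vector_endpoint_1[OF w] pure_basis_endpoint_1_line[OF w] w(2)
      represents_endpoint_1[OF w(1)] proots_char_poly_line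
    by (simp del: One_nat_def)
  have dim: "matrix_vs.dim T = 5"
    unfolding T_def by (rule dim_terwilliger_algebra) (simp add: assms(5))
  show ?thesis
  proof (intro conjI)
    show "\<forall>F. distance_regular F \<and> intersection_array F = ([3], [1]) \<longleftrightarrow> F = E"
      using distance_regular_array_iff assms(5) by simp
    show "spectrum_mset A = {#3#} + replicate_mset 3 (-1)"
      unfolding A_def using assms(5,6) by (rule spectrum_complete_graph_4)
    show "matrix_vs.dim T = 2^2 + 1^2" "matrix_vs.dim T = 5" by (simp_all add: dim)
    show "\<exists>W0 W1a W1b \<nu>a \<nu>b.
            orthogonal_decomposition T [W0, W1a, W1b]
          \<and> (\<forall>i<3. \<forall>j<3. T_isomorphic T ([W0, W1a, W1b] ! i) ([W0, W1a, W1b] ! j)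
                \<longleftrightarrow> [1, 2, 2 :: nat] ! i = [1, 2, 2] ! j)
          \<and> module_endpoint E x W0 = 0
          \<and> T_multiplicity T W0 = 1
          \<and> vec.dim W0 = 2
          \<and> module_diameter E x W0 = 1
          \<and> module_shape E x W0 = [1, 1]
          \<and> pure_basis E x W0 [estar E x 0, estar E x 1]
          \<and> represents_wrt B0 A [estar E x 0, estar E x 1]
          \<and> proots (char_poly B0) = {#3, -1#}
          \<and> essential_part ys \<nu>a = [1, -1, 0]
          \<and> essential_part ys \<nu>b = [1, 1, -2]
          \<and> (\<forall>(W, \<nu>) \<in> {(W1a, \<nu>a), (W1b, \<nu>b)}.
                module_endpoint E x W = 1
              \<and> T_multiplicity T W = 2
              \<and> vec.dim W = 1
              \<and> module_diameter E x W = 0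
              \<and> module_shape E x W = [1]
              \<and> pure_vector E x (module_endpoint E x W) \<nu>
              \<and> vec.span {\<nu>} = component E x (module_endpoint E x W) W
              \<and> vec.dim (component E x (module_endpoint E x W) W) = 1
              \<and> pure_basis E x W [\<nu>]
              \<and> represents_wrt B1 A [\<nu>]
              \<and> proots (char_poly B1) = {#-1#})"
    proof (rule exI[of _ ?W0], rule exI[of _ ?Wa], rule exI[of _ ?Wb], rule exI[of _ u],
        rule exI[of _ v], intro conjI)
      show "T_multiplicity T ?W0 = 1"
        using primary_multiplicity[OF dec[unfolded T_def]] by (simp add: T_def)
      show "represents_wrt B0 A [estar E x 0, estar E x 1]"
        unfolding B0_def A_def using assms(5) by (rule represents_primary)
      show "proots (char_poly B0) = {#3, -1#}"
        unfolding B0_def by (rule proots_char_poly_quotient)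
      show "\<forall>(W, \<nu>) \<in> {(?Wa, u), (?Wb, v)}.
                module_endpoint E x W = 1
              \<and> T_multiplicity T W = 2
              \<and> vec.dim W = 1
              \<and> module_diameter E x W = 0
              \<and> module_shape E x W = [1]
              \<and> pure_vector E x (module_endpoint E x W) \<nu>
              \<and> vec.span {\<nu>} = component E x (module_endpoint E x W) W
              \<and> vec.dim (component E x (module_endpoint E x W) W) = 1
              \<and> pure_basis E x W [\<nu>]
              \<and> represents_wrt B1 A [\<nu>]
              \<and> proots (char_poly B1) = {#-1#}"
        by (rule ballI, elim insertE emptyE; hypsubst; unfold prod.case; rule line; fact u v)
    qed (fact dec iso primary_data dim_primary_module pure_basis_primary ess)+
  qed
qed

end
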